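(* Let $t\in\mathbb{Q}$ be such that the six rational numbers $(t+i)^2$, $i\in\{0,\pm1,\pm2,3\}$, are pairwise distinct. Then there are infinitely many elliptic curves $C: y^2=ax^4+bx^2+c$ with $a,b,c\in\mathbb{Q}$ such that for every $i\in\{0,\pm1,\pm2,3\}$, $(t+i)^2$ is the $x$-coordinate of a point of $C(\mathbb{Q})$. In particular, there are infinitely many elliptic curves of the form $y^2=ax^4+bx^2+c$ over $\mathbb{Q}$ with $6$-term sequences of consecutive squares.
   Context: Let $C$ be an elliptic curve over $\mathbb{Q}$ given by $y^2=P(x)$ with $P\in\mathbb{Q}[x]$ of degree $3$ or $4$. A sequence of points $(x_i,y_i)\in C(\mathbb{Q})$, $i=1,\dots,n$, is a sequence of consecutive squares (of length $n$) if there is $u\in\mathbb{Q}$ with $x_i=(u+i)^2$ for $i=1,\dots,n$. *)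

theory Defs
  imports "HOL-Computational_Algebra.Polynomial"
begin

text \<open>The curve y^2 = P(x) over Q is an elliptic curve (in the paper's sense) when
  P has degree 3 or 4 and no repeated roots, i.e. P is coprime to its derivative.\<close>
definition elliptic_poly :: "rat poly \<Rightarrow> bool" where
  "elliptic_poly P \<longleftrightarrow> degree P \<in> {3, 4} \<and> coprime P (pderiv P)"

definition is_x_coord :: "rat poly \<Rightarrow> rat \<Rightarrow> bool" where
  "is_x_coord P x \<longleftrightarrow> (\<exists>y::rat. y^2 = poly P x)"

definition biquad :: "rat \<Rightarrow> rat \<Rightarrow> rat \<Rightarrow> rat poly" where
  "biquad a b c = [:c, 0, b, 0, a:]"

end

theory Submission
  imports Defs
begin

text \<open>
  Write \<open>X i = (t + i)^4\<close>; then \<open>a, b, c\<close> must make the quadratic \<open>a X\<^sup>2 + b X + c\<close> a square at the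
  six numbers \<open>X i\<close>. Let \<open>f\<close> be the monic polynomial with roots \<open>X i\<close> and let \<open>C\<close> be the cubic Taylor
  polynomial of \<open>sqrt (f x / f u)\<close> at a point \<open>u\<close>. Since \<open>f\<close> has degree at most \<open>6\<close>,
  \<open>f u * C\<^sup>2 - f = (x - u)^4 * q\<close> with \<open>q\<close> quadratic, and at every \<open>X i\<close> the value of \<open>f u * q\<close> is the
  square of \<open>f u * C (X i) / (X i - u)\<^sup>2\<close>. (On the Jacobian of \<open>y\<^sup>2 = f x\<close> this is duplication.)
  As \<open>u\<close> tends to a root \<open>r\<close> of \<open>f\<close>, the roots of \<open>q\<close> behave like \<open>r + (3 \<plusminus> 4\<i>) (u - r)\<close>, so the
  discriminant of \<open>q\<close> divided by the square of its leading coefficient is nonzero and tends to \<open>0\<close>.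
  Hence this invariant of the curve under scaling takes infinitely many values.
\<close>

text \<open>The Taylor coefficients at \<open>u\<close> are needed as polynomials in
  \<open>u\<close>, so that \<open>u\<close> can vary later. Allowing every
  \<open>n \<ge> degree f\<close> permits a fixed number of terms.\<close>

lemma poly_taylor_ex:
  fixes f :: "'a::idom poly"
  shows "\<exists>F. F 0 = f \<and> F 1 = pderiv f \<and>
    (\<forall>n\<ge>degree f. \<forall>u z. poly f (u + z) = (\<Sum>k\<le>n. poly (F k) u * z ^ k))"
proof (induction f)
  case 0
  show ?case by (intro exI[of _ "\<lambda>_. 0"]) simp
next
  case (pCons a g)
  from pCons.IH obtain G where G: "G 0 = g" "G 1 = pderiv g"
    "\<And>n u z. n \<ge> degree g \<Longrightarrow> poly g (u + z) = (\<Sum>k\<le>n. poly (G k) u * z ^ k)"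
    by blast
  show ?case
  proof (cases "g = 0")
    case True
    then show ?thesis
      by (intro exI[of _ "\<lambda>k. if k = 0 then [:a:] else 0"])
        (auto simp: pderiv_pCons if_distrib[of "\<lambda>p. poly p _"] if_distrib[of "\<lambda>x. x * _"]
          cong: if_cong)
  next
    case False
    \<comment> \<open>Multiplying the expansion of \<open>g\<close> by \<open>u + z\<close> keeps
      index \<open>k\<close> with a factor \<open>u\<close> and shifts \<open>k - 1\<close> to
      \<open>k\<close>.\<close>
    define H where "H k = (case k of 0 \<Rightarrow> pCons a (G 0) | Suc j \<Rightarrow> pCons 0 (G (Suc j)) + G j)" for k
    have "poly (pCons a g) (u + z) = (\<Sum>k\<le>n. poly (H k) u * z ^ k)"
      if n: "n \<ge> degree (pCons a g)" for n u z
    proof -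
      obtain m where m: "n = Suc m" "m \<ge> degree g"
        using n False by (cases n) auto
      have "(\<Sum>k\<le>n. poly (H k) u * z ^ k) =
          a + u * (\<Sum>k\<le>Suc m. poly (G k) u * z ^ k) + z * (\<Sum>k\<le>m. poly (G k) u * z ^ k)"
        unfolding m(1) sum.atMost_Suc_shift
        by (simp add: H_def algebra_simps sum.distrib sum_distrib_left)
      also have "\<dots> = a + u * poly g (u + z) + z * poly g (u + z)"
        using G(3)[of m u z] G(3)[of "Suc m" u z] m(2) by simp
      finally show ?thesis by (simp add: algebra_simps)
    qed
    moreover have "H 0 = pCons a g" "H 1 = pderiv (pCons a g)"
      using G by (simp_all add: H_def pderiv_pCons)
    ultimately show ?thesis by blast
  qed
qed

lemma elliptic_poly_biquad:
  assumes "a \<noteq> 0" "c \<noteq> 0" "b\<^sup>2 - 4 * a * c \<noteq> 0"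
  shows "elliptic_poly (biquad a b c)"
proof -
  let ?P = "biquad a b c" and ?D = "b\<^sup>2 - 4 * a * c"
  have P': "pderiv ?P = [:0, 2 * b, 0, 4 * a:]"
    by (simp add: biquad_def pderiv_pCons)
  have "coprime ?P (pderiv ?P)"
  proof (rule coprimeI)
    fix d assume "d dvd ?P" "d dvd pderiv ?P"
    \<comment> \<open>With \<open>s = 2*a*x^2 + b\<close> one has \<open>pderiv ?P = 2*x*s\<close>
      and \<open>s^2 = 4*a*?P + ?D\<close>, so the inner bracket is \<open>2*?D*x\<close>; the outer
      difference then cancels all but \<open>?D*c\<close>.\<close>
    then have "d dvd [:?D:] * ?P - [:0, b / 2, 0, a / 2:] * ([:b, 0, 2 * a:] * pderiv ?P - [:0, 8 * a:] * ?P)"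
      by (intro dvd_diff dvd_mult)
    also have "\<dots> = [:?D * c:]"
      unfolding P' by (simp add: biquad_def algebra_simps power2_eq_square)
    finally show "is_unit d"
      using assms by (elim dvd_unit_imp_unit) (simp add: is_unit_const_poly_iff dvd_field_iff)
  qed
  moreover have "degree ?P = 4" using assms(1) by (simp add: biquad_def)
  ultimately show ?thesis by (simp add: elliptic_poly_def)
qed

text \<open>With \<open>z = x - u\<close>, the coefficients \<open>a, b, c\<close> below are those of \<open>256 * f0^5 * q\<close>.\<close>

lemma sqrt_taylor_identity:
  fixes f0 f1 f2 f3 f4 f5 f6 z :: "'a::comm_ring_1"
  defines "e2 \<equiv> 4 * f0 * f2 - f1\<^sup>2"
    and "e3 \<equiv> 8 * f0\<^sup>2 * f3 - 4 * f0 * f1 * f2 + f1 ^ 3"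
  defines "a \<equiv> e3\<^sup>2 - 256 * f0 ^ 5 * f6"
    and "b \<equiv> 4 * f0 * e2 * e3 - 256 * f0 ^ 5 * f5"
    and "c \<equiv> f0\<^sup>2 * (4 * e2\<^sup>2 + 16 * f1 * e3) - 256 * f0 ^ 5 * f4"
  shows "(16 * f0 ^ 3 + 8 * f0\<^sup>2 * f1 * z + 2 * f0 * e2 * z\<^sup>2 + e3 * z ^ 3)\<^sup>2 -
    256 * f0 ^ 5 * (f0 + f1 * z + f2 * z\<^sup>2 + f3 * z ^ 3 + f4 * z ^ 4 + f5 * z ^ 5 + f6 * z ^ 6) =
    z ^ 4 * (a * z\<^sup>2 + b * z + c)"
  unfolding a_def b_def c_def e2_def e3_def
  by (simp add: algebra_simps eval_nat_numeral)

text \<open>For \<open>v \<noteq> 0\<close> the polynomial \<open>p - v*d\<close> is nonzero at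
  \<open>r\<close>, so the ratio takes the value \<open>v\<close> only finitely often, on a cofinite
  domain. The factor \<open>q\<close> allows one further nonvanishing condition.\<close>

lemma infinite_polynomial_ratios:
  fixes p d q :: "'a::field_char_0 poly"
  assumes "poly p r = 0" "poly d r \<noteq> 0" "q \<noteq> 0" "p \<noteq> 0"
  shows "infinite ((\<lambda>u. poly p u / poly d u) ` {u. poly q u \<noteq> 0 \<and> poly p u \<noteq> 0 \<and> poly d u \<noteq> 0})"
proof
  let ?h = "\<lambda>u. poly p u / poly d u"
  let ?U = "{u. poly q u \<noteq> 0 \<and> poly p u \<noteq> 0 \<and> poly d u \<noteq> 0}"
  have "q * p * d \<noteq> 0" using assms by auto
  then have "finite {u. poly (q * p * d) u = 0}" by (rule poly_roots_finite)
  then have inf: "infinite (- {u. poly (q * p * d) u = 0})"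
    using infinite_UNIV_char_0 finite_Diff2[of _ UNIV] by (auto simp: Compl_eq_Diff_UNIV)
  have U: "- {u. poly (q * p * d) u = 0} = ?U" by auto
  assume "finite (?h ` ?U)"
  moreover have "finite (?h -` {v} \<inter> ?U)" for v
  proof (cases "v = 0")
    case True
    then have "?h -` {v} \<inter> ?U = {}" by auto
    then show ?thesis by simp
  next
    case False
    then have "poly (p - smult v d) r \<noteq> 0" using assms by simp
    then have "p - smult v d \<noteq> 0" by auto
    then have "finite {u. poly (p - smult v d) u = 0}" by (rule poly_roots_finite)
    then show ?thesis by (rule rev_finite_subset) (auto simp: field_simps)
  qed
  ultimately have "finite ?U"
    using inf_img_fin_dom'[of ?h ?U] by (metis (no_types, lifting) imageE)
  with inf U show False by simp
qed

text \<open>The preceding ratio argument applies in the variable \<open>u\<close>, near the root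
  \<open>r\<close>. The condition \<open>r \<noteq> 0\<close> ensures that the constant coefficient
  \<open>c'\<close> is not identically zero.\<close>

lemma infinite_elliptic_biquads_through:
  fixes R :: "rat set"
  assumes R: "finite R" "card R \<le> 6" and r: "r \<in> R" "r \<noteq> 0"
  shows "infinite {(b\<^sup>2 - 4 * a * c) / a\<^sup>2 | a b c. a \<noteq> 0 \<and> elliptic_poly (biquad a b c) \<and>
    (\<forall>x\<in>R. \<exists>y. y\<^sup>2 = a * x\<^sup>2 + b * x + c)}" (is "infinite ?V")
proof -
  define f where "f = (\<Prod>x\<in>R. [:-x, 1:])"
  have deg: "degree f \<le> 6"
    using degree_prod_sum_le[OF R(1), of "\<lambda>x. [:-x, 1:]"] R(2) by (simp add: f_def o_def)
  have root: "poly f x = 0" if "x \<in> R" for x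
    using that R(1) by (auto simp: f_def poly_prod)
  obtain F where F: "F 0 = f" "F 1 = pderiv f"
    "\<And>u z. poly f (u + z) = (\<Sum>k\<le>6. poly (F k) u * z ^ k)"
    using poly_taylor_ex[of f] deg by blast
  have f1: "poly (F 1) r \<noteq> 0"
  proof -
    have "f = [:-r, 1:] * (\<Prod>x\<in>R - {r}. [:-x, 1:])"
      unfolding f_def using R(1) r(1) by (rule prod.remove)
    then have "poly (pderiv f) r = (\<Prod>x\<in>R - {r}. r - x)"
      by (simp add: pderiv_mult pderiv_pCons poly_prod del: mult_pCons_left)
    then show ?thesis using R(1) F(2) by auto
  qed
  have f0: "poly (F 0) r = 0" using F(1) root r by simp
  \<comment> \<open>\<open>e2 / (8*(F 0)^2)\<close> and \<open>e3 / (16*(F 0)^3)\<close> are the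
    last two coefficients of the cubic \<open>C\<close>; clearing denominators keeps everything
    polynomial in \<open>u\<close>.\<close>
  define e2 where "e2 = 4 * F 0 * F 2 - (F 1)\<^sup>2"
  define e3 where "e3 = 8 * (F 0)\<^sup>2 * F 3 - 4 * F 0 * F 1 * F 2 + F 1 ^ 3"
  define a where "a = e3\<^sup>2 - 256 * F 0 ^ 5 * F 6"
  define b where "b = 4 * F 0 * e2 * e3 - 256 * F 0 ^ 5 * F 5"
  define c where "c = (F 0)\<^sup>2 * (4 * e2\<^sup>2 + 16 * F 1 * e3) - 256 * F 0 ^ 5 * F 4"
  \<comment> \<open>Substituting \<open>z = x - u\<close> turns \<open>a*z^2 + b*z + c\<close> into
    \<open>a*x^2 + b'*x + c'\<close>; here \<open>[:0, 1:]\<close> stands for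
    \<open>u\<close>.\<close>
  define b' where "b' = b - 2 * a * [:0, 1:]"
  define c' where "c' = a * [:0, 1:]\<^sup>2 - b * [:0, 1:] + c"
  \<comment> \<open>\<open>F 0\<close> divides \<open>b\<close> and \<open>(F 0)^2\<close> divides
    \<open>c\<close>, so the discriminant has the factor \<open>(F 0)^2\<close>, which makes it
    vanish at \<open>r\<close>; \<open>G\<close> is the cofactor.\<close>
  define G where "G = (4 * e2 * e3 - 256 * F 0 ^ 4 * F 5)\<^sup>2 -
    4 * a * (4 * e2\<^sup>2 + 16 * F 1 * e3 - 256 * F 0 ^ 3 * F 4)"
  have disc: "b'\<^sup>2 - 4 * a * c' = (F 0)\<^sup>2 * G"
  proof -
    have "b'\<^sup>2 - 4 * a * c' = b\<^sup>2 - 4 * a * c" unfolding b'_def c'_def by algebra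
    also have "\<dots> = (F 0)\<^sup>2 * G" unfolding G_def b_def c_def by algebra
    finally show ?thesis .
  qed
  have [simp]: "poly (numeral n) u = numeral n" for n and u :: rat
    by (metis of_nat_numeral poly_of_nat)
  have e2r: "poly e2 r = - (poly (F 1) r)\<^sup>2" and e3r: "poly e3 r = poly (F 1) r ^ 3"
    by (simp_all add: e2_def e3_def f0)
  have ar: "poly a r = poly (F 1) r ^ 6"
    by (simp add: a_def e3r f0 flip: power_mult)
  have Gr: "poly G r = - 64 * poly (F 1) r ^ 10"
    by (simp add: G_def e2r e3r ar f0) algebra
  have c'r: "poly c' r = poly (F 1) r ^ 6 * r\<^sup>2"
    by (simp add: c'_def b_def c_def ar f0)
  have "F 0 \<noteq> 0" using F(1) R(1) by (auto simp: f_def)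
  have inf: "infinite ((\<lambda>u. poly ((F 0)\<^sup>2 * G) u / poly (a\<^sup>2) u) `
      {u. poly c' u \<noteq> 0 \<and> poly ((F 0)\<^sup>2 * G) u \<noteq> 0 \<and> poly (a\<^sup>2) u \<noteq> 0})"
  proof (rule infinite_polynomial_ratios)
    show "poly ((F 0)\<^sup>2 * G) r = 0" "poly (a\<^sup>2) r \<noteq> 0" using f0 f1 ar by simp_all
    show "c' \<noteq> 0" "(F 0)\<^sup>2 * G \<noteq> 0" using c'r Gr f1 r(2) \<open>F 0 \<noteq> 0\<close> by auto
  qed
  show ?thesis
  proof (rule infinite_super[OF _ inf], safe)
    fix u
    assume u: "poly c' u \<noteq> 0" "poly ((F 0)\<^sup>2 * G) u \<noteq> 0" "poly (a\<^sup>2) u \<noteq> 0"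
    have d: "poly ((F 0)\<^sup>2 * G) u = (poly b' u)\<^sup>2 - 4 * poly a u * poly c' u"
      unfolding disc[symmetric] by simp
    have "\<exists>y. y\<^sup>2 = poly a u * x\<^sup>2 + poly b' u * x + poly c' u" if "x \<in> R" for x
    proof -
      define z where "z = x - u"
      define w where "w = 16 * poly (F 0) u ^ 3 + 8 * (poly (F 0) u)\<^sup>2 * poly (F 1) u * z +
        2 * poly (F 0) u * poly e2 u * z\<^sup>2 + poly e3 u * z ^ 3"
      have "poly f (u + z) = 0" using root[OF that] by (simp add: z_def)
      then have "poly (F 0) u + poly (F 1) u * z + poly (F 2) u * z\<^sup>2 + poly (F 3) u * z ^ 3 +
          poly (F 4) u * z ^ 4 + poly (F 5) u * z ^ 5 + poly (F 6) u * z ^ 6 = 0"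
        unfolding F(3) by (simp add: eval_nat_numeral)
      then have "w\<^sup>2 = z ^ 4 * (poly a u * z\<^sup>2 + poly b u * z + poly c u)"
        using sqrt_taylor_identity[of "poly (F 0) u" "poly (F 1) u" z "poly (F 2) u" "poly (F 3) u"
            "poly (F 4) u" "poly (F 5) u" "poly (F 6) u"]
        by (simp add: w_def a_def b_def c_def e2_def e3_def)
      moreover have "poly a u * z\<^sup>2 + poly b u * z + poly c u =
          poly a u * x\<^sup>2 + poly b' u * x + poly c' u"
        by (simp add: z_def b'_def c'_def algebra_simps power2_eq_square)
      \<comment> \<open>\<open>F 0\<close> does not vanish at \<open>u\<close>, so \<open>u\<close>
        is no root of \<open>f\<close>.\<close>
      moreover have "z \<noteq> 0"
        using u(2) root[OF that] F(1) by (auto simp: z_def)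
      ultimately have "(w / z\<^sup>2)\<^sup>2 = poly a u * x\<^sup>2 + poly b' u * x + poly c' u"
        by (simp add: power_divide flip: power_mult)
      then show ?thesis by blast
    qed
    moreover have "poly a u \<noteq> 0" using u(3) by simp
    moreover have "elliptic_poly (biquad (poly a u) (poly b' u) (poly c' u))"
      using u d by (intro elliptic_poly_biquad) auto
    ultimately show "\<exists>a' b'' c''. poly ((F 0)\<^sup>2 * G) u / poly (a\<^sup>2) u = (b''\<^sup>2 - 4 * a' * c'') / a'\<^sup>2 \<and>
        a' \<noteq> 0 \<and> elliptic_poly (biquad a' b'' c'') \<and> (\<forall>x\<in>R. \<exists>y. y\<^sup>2 = a' * x\<^sup>2 + b'' * x + c'')"
      using d by (intro exI[of _ "poly a u"] exI[of _ "poly b' u"] exI[of _ "poly c' u"]) auto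
  qed
qed

theorem theorem3:
  fixes t :: rat
  assumes "inj_on (\<lambda>i::int. (t + of_int i)^2) {-2, -1, 0, 1, 2, 3}"
  shows "\<exists>S :: (rat \<times> rat \<times> rat) set. infinite S \<and>
    (\<forall>(a, b, c) \<in> S. elliptic_poly (biquad a b c) \<and>
       (\<forall>i \<in> {-2, -1, 0, 1, 2, 3::int}. is_x_coord (biquad a b c) ((t + of_int i)^2))) \<and>
    (\<forall>(a, b, c) \<in> S. \<forall>(a', b', c') \<in> S. \<forall>m::rat.
       m \<noteq> 0 \<and> a' = m^2 * a \<and> b' = m^2 * b \<and> c' = m^2 * c \<longrightarrow> (a, b, c) = (a', b', c'))"
proof -
  let ?I = "{-2, -1, 0, 1, 2, 3::int}"
  \<comment> \<open>The quartic is a quadratic in the square of its argument, here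
    \<open>(t + i)^4\<close>.\<close>
  define R where "R = (\<lambda>i. (t + of_int i) ^ 4) ` ?I"
  have "finite R" "card R \<le> 6"
    using card_image_le[of ?I "\<lambda>i. (t + of_int i) ^ 4"] by (simp_all add: R_def)
  moreover obtain r where "r \<in> R" "r \<noteq> 0"
  proof (cases "t = 0")
    case True
    show ?thesis by (rule that[of 1]) (simp_all add: R_def True)
  next
    case False
    show ?thesis by (rule that[of "t ^ 4"]) (use False in \<open>simp_all add: R_def\<close>)
  qed
  ultimately have inf: "infinite {(b\<^sup>2 - 4 * a * c) / a\<^sup>2 | a b c. a \<noteq> 0 \<and>
      elliptic_poly (biquad a b c) \<and> (\<forall>x\<in>R. \<exists>y. y\<^sup>2 = a * x\<^sup>2 + b * x + c)}"
    by (rule infinite_elliptic_biquads_through)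
  define T where "T = {(a, b, c). a \<noteq> 0 \<and> elliptic_poly (biquad a b c) \<and>
      (\<forall>x\<in>R. \<exists>y. y\<^sup>2 = a * x\<^sup>2 + b * x + c)}"
  define h where "h = (\<lambda>(a, b, c). (b\<^sup>2 - 4 * a * c) / a\<^sup>2 :: rat)"
  have "infinite (h ` T)"
    by (rule infinite_super[OF _ inf]) (force simp: h_def T_def)
  \<comment> \<open>\<open>S\<close> keeps one triple for each value of \<open>h\<close>. Scaling by
    \<open>m^2\<close> preserves \<open>h\<close>, so two triples of \<open>S\<close> related by it
    coincide.\<close>
  obtain S where S: "S \<subseteq> T" "inj_on h S" "h ` S = h ` T"
    using subset_image_inj[of "h ` T" h T] by auto
  have "infinite S"
    using \<open>infinite (h ` T)\<close> S(3) by (metis finite_imageI)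
  moreover have "elliptic_poly (biquad a b c) \<and> (\<forall>i\<in>?I. is_x_coord (biquad a b c) ((t + of_int i)^2))"
    if "(a, b, c) \<in> S" for a b c
  proof -
    have abc: "elliptic_poly (biquad a b c)" "\<forall>x\<in>R. \<exists>y. y\<^sup>2 = a * x\<^sup>2 + b * x + c"
      using that S(1) by (auto simp: T_def)
    have "is_x_coord (biquad a b c) ((t + of_int i)\<^sup>2)" if "i \<in> ?I" for i
    proof -
      have "(t + of_int i) ^ 4 \<in> R" unfolding R_def using that by (rule imageI)
      then obtain y where "y\<^sup>2 = a * ((t + of_int i) ^ 4)\<^sup>2 + b * (t + of_int i) ^ 4 + c"
        using abc(2) by blast
      also have "\<dots> = poly (biquad a b c) ((t + of_int i)\<^sup>2)"
        unfolding biquad_def by simp algebra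
      finally show ?thesis unfolding is_x_coord_def by blast
    qed
    with abc(1) show ?thesis by blast
  qed
  moreover have "(a, b, c) = (m\<^sup>2 * a, m\<^sup>2 * b, m\<^sup>2 * c)"
    if "(a, b, c) \<in> S" "(m\<^sup>2 * a, m\<^sup>2 * b, m\<^sup>2 * c) \<in> S" "m \<noteq> 0" for a b c m
  proof (rule inj_onD[OF S(2) _ that(1,2)])
    have "a \<noteq> 0" using that(1) S(1) by (auto simp: T_def)
    with that(3) show "h (a, b, c) = h (m\<^sup>2 * a, m\<^sup>2 * b, m\<^sup>2 * c)"
      by (simp add: h_def divide_simps) algebra
  qed
  ultimately show ?thesis
    by (intro exI[of _ S]) blast
qed

end
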